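(* Let $\Delta=(\Sigma,\beta)$ and $\Delta'=(\Sigma,\beta')$ be complete non-singular topological fans of dimension $n$ on the same simplicial complex $\Sigma$, with $\beta_i=(b_i+\sqrt{-1}c_i,v_i)$ and $\beta'_i=(b'_i+\sqrt{-1}c'_i,v'_i)$, and suppose $v_i=v'_i$ for every vertex $i$. Then $X(\Delta)$ and $X(\Delta')$ are $(S^1)^n$-equivariantly homeomorphic, where $(S^1)^n\subset(\mathbb C^* )^n$ acts by restriction.
   Context: $\mathcal R$ denotes the ring of real $2\times2$ matrices $\begin{bmatrix} b&0\\ c&v\end{bmatrix}$ with $b,c\in\mathbb R$, $v\in\mathbb Z$, identified with $\mathbb C\times\mathbb Z$ via $(b+\sqrt{-1}c,v)$; for $g\in\mathbb C^*$, $g^\mu:=|g|^{b+\sqrt{-1}c}(g/|g|)^v$, with $(g^{\mu_1})^{\mu_2}=g^{\mu_2\mu_1}$. For $\beta=(\beta^1,\dots,\beta^n)\in\mathcal R^n=\mathbb C^n\times\mathbb Z^n$, $\lambda_\beta(g)=(g^{\beta^1},\dots,g^{\beta^n})$, and $\langle\alpha,\beta\rangle=\sum_k\alpha^k\beta^k$. A topological fan of dimension $n$ is $(\Sigma,\beta)$, $\Sigma$ an abstract finite simplicial complex of dimension $n-1$ with vertex set $[m]$, $\beta:[m]\to\mathcal R^n$, $\beta_i=(b_i+\sqrt{-1}c_i,v_i)$, such that the cones $\angle b_I$ spanned by $\{b_i\}_{i\in I}$, $I\in\Sigma$, are simplicial (the $b_i$, $i\in I$, linearly independent) with $\angle b_I\cap\angle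 b_J=\angle b_{I\cap J}$, and each $v_i$ is primitive with $\{v_i\}_{i\in I}$ linearly independent for $I\in\Sigma$. Complete: $\bigcup_{I}\angle b_I=\mathbb R^n$. Non-singular: $\{v_i\}_{i\in I}$ is part of a $\mathbb Z$-basis for each $I\in\Sigma$. $X(\Delta)$: with $U(I)=\{z\in\mathbb C^m:z_i\ne0\ \forall i\notin I\}$, $U(\Sigma)=\bigcup_{I\in\Sigma}U(I)$, $\lambda:(\mathbb C^* )^m\to(\mathbb C^* )^n$, $\lambda(h)=\prod_k\lambda_{\beta_k}(h_k)$, set $X(\Delta)=U(\Sigma)/\ker\lambda$ with the action of $(\mathbb C^* )^m/\ker\lambda\cong(\mathbb C^* )^n$ (via $\lambda$) induced by coordinatewise multiplication. *)

theory Defs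
  imports "HOL-Analysis.Analysis"
begin

definition quot_open :: "'a topology \<Rightarrow> ('a \<Rightarrow> 'b) \<Rightarrow> 'b set \<Rightarrow> bool" where
  "quot_open X q S \<longleftrightarrow> S \<subseteq> q ` topspace X \<and> openin X {z \<in> topspace X. q z \<in> S}"

lemma istopology_quot_open: "istopology (quot_open X q)"
  unfolding istopology_def quot_open_def
proof (intro conjI allI impI)
  fix S T assume S: "S \<subseteq> q ` topspace X \<and> openin X {z \<in> topspace X. q z \<in> S}"
    and T: "T \<subseteq> q ` topspace X \<and> openin X {z \<in> topspace X. q z \<in> T}"
  have e: "{z \<in> topspace X. q z \<in> S \<inter> T} = {z \<in> topspace X. q z \<in> S} \<inter> {z \<in> topspace X. q z \<in> T}" by blast
  show "S \<inter> T \<subseteq> q ` topspace X" using S by blast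
  show "openin X {z \<in> topspace X. q z \<in> S \<inter> T}"
    unfolding e using S T by auto
next
  fix K assume K: "\<forall>S\<in>K. S \<subseteq> q ` topspace X \<and> openin X {z \<in> topspace X. q z \<in> S}"
  have e: "{z \<in> topspace X. q z \<in> \<Union>K} = (\<Union>S\<in>K. {z \<in> topspace X. q z \<in> S})" by blast
  show "\<Union>K \<subseteq> q ` topspace X" using K by blast
  show "openin X {z \<in> topspace X. q z \<in> \<Union>K}"
    unfolding e using K by auto
qed

definition quotient_topology :: "'a topology \<Rightarrow> ('a \<Rightarrow> 'b) \<Rightarrow> 'b topology" where
  "quotient_topology X q = topology (quot_open X q)"

text \<open>An element of R is a pair (mu, v) with mu = b + i c complex and v integer.
  For g nonzero complex: g^(mu,v) = |g|^mu * (g/|g|)^v, with |g|^mu = exp(mu * ln |g|).\<close>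

type_synonym ringR = "complex \<times> int"

definition Rpow :: "complex \<Rightarrow> ringR \<Rightarrow> complex" where
  "Rpow g \<mu> = exp (fst \<mu> * complex_of_real (ln (cmod g))) * (g / complex_of_real (cmod g)) powi (snd \<mu>)"

text \<open>A characteristic function beta: [m] -> R^n = C^n x Z^n, vertices indexed by the
  finite type 'm, coordinates of R^n by the finite type 'n.\<close>

definition bvec :: "('m \<Rightarrow> (complex^'n) \<times> (int^'n)) \<Rightarrow> 'm \<Rightarrow> real^'n" where
  "bvec \<beta> i = (\<chi> k. Re (fst (\<beta> i) $ k))"

definition vvec :: "('m \<Rightarrow> (complex^'n) \<times> (int^'n)) \<Rightarrow> 'm \<Rightarrow> int^'n" where
  "vvec \<beta> i = snd (\<beta> i)"

definition simplicial_complex_on :: "'m set set \<Rightarrow> nat \<Rightarrow> bool" where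
  "simplicial_complex_on \<Sigma> d \<longleftrightarrow>
     (\<forall>I\<in>\<Sigma>. \<forall>J. J \<subseteq> I \<longrightarrow> J \<in> \<Sigma>) \<and>
     (\<forall>i. {i} \<in> \<Sigma>) \<and>
     (\<forall>I\<in>\<Sigma>. card I \<le> d + 1) \<and> (\<exists>I\<in>\<Sigma>. card I = d + 1)"

definition cone_of :: "('m \<Rightarrow> real^'n) \<Rightarrow> 'm set \<Rightarrow> (real^'n) set" where
  "cone_of b I = {(\<Sum>i\<in>I. a i *\<^sub>R b i) | a. \<forall>i\<in>I. a i \<ge> 0}"

definition primitive :: "int^'n \<Rightarrow> bool" where
  "primitive v \<longleftrightarrow> (\<forall>(k::int) w. v = k *s w \<longrightarrow> k = 1 \<or> k = -1)"

definition int_lin_indep :: "('m \<Rightarrow> int^'n) \<Rightarrow> 'm set \<Rightarrow> bool" where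
  "int_lin_indep v I \<longleftrightarrow> (\<forall>a::'m \<Rightarrow> int. (\<Sum>i\<in>I. a i *s v i) = 0 \<longrightarrow> (\<forall>i\<in>I. a i = 0))"

definition Z_basis :: "(int^'n) set \<Rightarrow> bool" where
  "Z_basis B \<longleftrightarrow> finite B \<and>
     (\<forall>x. \<exists>!a::int^'n \<Rightarrow> int. (\<forall>w. w \<notin> B \<longrightarrow> a w = 0) \<and> x = (\<Sum>w\<in>B. a w *s w))"

definition part_of_Z_basis :: "('m \<Rightarrow> int^'n) \<Rightarrow> 'm set \<Rightarrow> bool" where
  "part_of_Z_basis v I \<longleftrightarrow> inj_on v I \<and> (\<exists>B. v ` I \<subseteq> B \<and> Z_basis B)"

definition topological_fan ::
  "'m set set \<Rightarrow> ('m \<Rightarrow> (complex^'n) \<times> (int^'n)) \<Rightarrow> bool" where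
  "topological_fan \<Sigma> \<beta> \<longleftrightarrow>
     simplicial_complex_on \<Sigma> (CARD('n) - 1) \<and>
     (\<forall>I\<in>\<Sigma>. inj_on (bvec \<beta>) I \<and> independent (bvec \<beta> ` I)) \<and>
     (\<forall>I\<in>\<Sigma>. \<forall>J\<in>\<Sigma>. cone_of (bvec \<beta>) I \<inter> cone_of (bvec \<beta>) J = cone_of (bvec \<beta>) (I \<inter> J)) \<and>
     (\<forall>i. primitive (vvec \<beta> i)) \<and>
     (\<forall>I\<in>\<Sigma>. int_lin_indep (vvec \<beta>) I)"

definition complete_fan :: "'m set set \<Rightarrow> ('m \<Rightarrow> (complex^'n) \<times> (int^'n)) \<Rightarrow> bool" where
  "complete_fan \<Sigma> \<beta> \<longleftrightarrow> (\<Union>I\<in>\<Sigma>. cone_of (bvec \<beta>) I) = UNIV"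

definition nonsingular_fan :: "'m set set \<Rightarrow> ('m \<Rightarrow> (complex^'n) \<times> (int^'n)) \<Rightarrow> bool" where
  "nonsingular_fan \<Sigma> \<beta> \<longleftrightarrow> (\<forall>I\<in>\<Sigma>. part_of_Z_basis (vvec \<beta>) I)"

definition cmult :: "complex^'m \<Rightarrow> complex^'m \<Rightarrow> complex^'m" where
  "cmult h z = (\<chi> k. h $ k * z $ k)"

definition Ustar :: "(complex^'m) set" where
  "Ustar = {h. \<forall>k. h $ k \<noteq> 0}"

definition U_of :: "'m set \<Rightarrow> (complex^'m) set" where
  "U_of I = {z. \<forall>i. i \<notin> I \<longrightarrow> z $ i \<noteq> 0}"

definition U_Sigma :: "'m set set \<Rightarrow> (complex^'m) set" where
  "U_Sigma \<Sigma> = (\<Union>I\<in>\<Sigma>. U_of I)"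

definition lam :: "('m::finite \<Rightarrow> (complex^'n) \<times> (int^'n)) \<Rightarrow> complex^'m \<Rightarrow> complex^'n" where
  "lam \<beta> h = (\<chi> j. \<Prod>k\<in>UNIV. Rpow (h $ k) (fst (\<beta> k) $ j, snd (\<beta> k) $ j))"

definition ker_lam :: "('m::finite \<Rightarrow> (complex^'n) \<times> (int^'n)) \<Rightarrow> (complex^'m) set" where
  "ker_lam \<beta> = {h \<in> Ustar. lam \<beta> h = (\<chi> j. 1)}"

definition orbit_of :: "('m::finite \<Rightarrow> (complex^'n) \<times> (int^'n)) \<Rightarrow> complex^'m \<Rightarrow> (complex^'m) set" where
  "orbit_of \<beta> z = {cmult h z | h. h \<in> ker_lam \<beta>}"

definition X_space :: "'m::finite set set \<Rightarrow> ('m \<Rightarrow> (complex^'n) \<times> (int^'n)) \<Rightarrow> (complex^'m) set topology" where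
  "X_space \<Sigma> \<beta> = quotient_topology (top_of_set (U_Sigma \<Sigma>)) (orbit_of \<beta>)"

text \<open>Action of t in (C*)^n on X(Delta), induced via lambda: t . [z] = [h z] where lambda(h) = t.\<close>
definition X_act :: "('m::finite \<Rightarrow> (complex^'n) \<times> (int^'n)) \<Rightarrow> complex^'n \<Rightarrow> (complex^'m) set \<Rightarrow> (complex^'m) set" where
  "X_act \<beta> t Ob = {cmult h z | h z. h \<in> Ustar \<and> lam \<beta> h = t \<and> z \<in> Ob}"

definition S1_torus :: "(complex^'n) set" where
  "S1_torus = {t. \<forall>j. cmod (t $ j) = 1}"

end

theory Submission
  imports Defs
begin

text \<open>
  The elements of the kernel of \<open>\<lambda>\<close> have a radial part \<open>exp y\<close> with \<open>\<Sum> y\<^sub>k b\<^sub>k = 0\<close>. Completeness of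
  the fan of the \<open>b\<^sub>k\<close> says that for every point \<open>z\<close> of \<open>U(\<Sigma>)\<close> there is exactly one such \<open>y\<close> that
  moves \<open>z\<close> into the moment-angle complex \<open>Z\<close>, the set of points of the unit polydisc whose
  coordinates of modulus less than 1 form a simplex, and \<open>y\<close> depends continuously on \<open>z\<close>. The vectors
  \<open>v\<^sub>k\<close> span, so the radial element can be corrected by phases to lie in the kernel. This gives a
  continuous retraction of \<open>U(\<Sigma>)\<close> onto \<open>Z\<close> along the orbits. Two points of \<open>Z\<close> in one orbit differ by
  an element of the compact torus, where \<open>\<lambda>\<close> depends only on the \<open>v\<^sub>k\<close>. Hence matching the orbits
  that meet \<open>Z\<close> in the same points is a homeomorphism for two fans with equal \<open>v\<^sub>k\<close>.
\<close>

subsection \<open>Linear relations between the rays of a fan\<close>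

text \<open>\<open>independent\<close> speaks of sets, while cones are indexed by vertices.
  Injectivity turns coefficients indexed by \<open>I\<close> into coefficients on the image
  set.\<close>

lemma independent_family_cong:
  fixes b :: "'m::finite \<Rightarrow> 'v::real_vector"
  assumes "inj_on b I" "independent (b ` I)"
    and "(\<Sum>k\<in>I. x k *\<^sub>R b k) = (\<Sum>k\<in>I. y k *\<^sub>R b k)" and "k \<in> I"
  shows "x k = y k"
proof -
  define c where "c v = x (the_inv_into I b v) - y (the_inv_into I b v)" for v
  have "(\<Sum>v\<in>b ` I. c v *\<^sub>R v) = (\<Sum>k\<in>I. (x k - y k) *\<^sub>R b k)"
    using assms(1) by (subst sum.reindex) (auto simp: c_def the_inv_into_f_f intro!: sum.cong)
  also have "\<dots> = 0"
    using assms(3) by (simp add: scaleR_left_diff_distrib sum_subtractf)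
  finally have "c (b k) = 0"
    using independentD[OF assms(2), of "b ` I" c "b k"] assms(4) by simp
  then show ?thesis using assms(1,4) by (simp add: c_def the_inv_into_f_f)
qed

text \<open>The conditions of \<open>topological_fan\<close> on the real vectors, together with
  closure of \<Sigma> under subsets, for a bare family \<open>b\<close>. The radial arguments rest
  on these and on completeness.\<close>

definition simplicial_fan :: "'m set set \<Rightarrow> ('m \<Rightarrow> real^'n) \<Rightarrow> bool" where
  "simplicial_fan \<Sigma> b \<longleftrightarrow>
     (\<forall>I\<in>\<Sigma>. \<forall>J. J \<subseteq> I \<longrightarrow> J \<in> \<Sigma>) \<and>
     (\<forall>I\<in>\<Sigma>. inj_on b I \<and> independent (b ` I)) \<and>
     (\<forall>I\<in>\<Sigma>. \<forall>J\<in>\<Sigma>. cone_of b I \<inter> cone_of b J = cone_of b (I \<inter> J))"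

text \<open>The sign conditions arise on comparing two radial moves of one point into the
  moment-angle complex, where \<open>I\<close> and \<open>J\<close> contain the coordinates of
  modulus less than 1 after each move. Positive terms sit on \<open>J\<close>, negative ones on
  \<open>I\<close>, and simplicial cones that meet in common faces leave no room for such a
  relation.\<close>

lemma fan_relation_eq_0:
  fixes b :: "'m::finite \<Rightarrow> real^'n"
  assumes fan: "simplicial_fan \<Sigma> b" and IJ: "I \<in> \<Sigma>" "J \<in> \<Sigma>"
    and rel: "(\<Sum>k\<in>UNIV. u k *\<^sub>R b k) = 0"
    and J: "\<And>k. k \<notin> J \<Longrightarrow> u k \<le> 0" and I: "\<And>k. k \<notin> I \<Longrightarrow> 0 \<le> u k"
  shows "u k = 0"
proof -
  \<comment> \<open>Moving the negative terms to the other side and adding \<open>t\<close> times the rays common to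
    \<open>I\<close> and \<open>J\<close> exhibits one point of both cones, hence of their common face.\<close>
  define t where "t = (\<Sum>k\<in>UNIV. \<bar>u k\<bar>)"
  have t: "\<bar>u k\<bar> \<le> t" for k
    unfolding t_def by (rule member_le_sum) auto
  have t0: "0 \<le> t" using t[of k] by linarith
  define p where "p k = (if k \<in> I then t + u k else u k)" for k
  define q where "q k = (if k \<in> J then t else - u k)" for k
  have "(\<Sum>k\<in>J. p k *\<^sub>R b k) - (\<Sum>k\<in>I. q k *\<^sub>R b k)
      = (\<Sum>k\<in>UNIV. (if k \<in> J then p k else 0) *\<^sub>R b k) - (\<Sum>k\<in>UNIV. (if k \<in> I then q k else 0) *\<^sub>R b k)"
    by (simp add: if_distrib[of "\<lambda>x. x *\<^sub>R _"] sum.If_cases cong: if_cong)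
  also have "\<dots> = (\<Sum>k\<in>UNIV. u k *\<^sub>R b k)"
    unfolding sum_subtractf[symmetric]
    using I J by (intro sum.cong) (auto simp: p_def q_def scaleR_left_distrib antisym)
  finally have pq: "(\<Sum>k\<in>J. p k *\<^sub>R b k) = (\<Sum>k\<in>I. q k *\<^sub>R b k)" using rel by simp
  have "(\<Sum>k\<in>J. p k *\<^sub>R b k) \<in> cone_of b J"
  proof -
    have "\<forall>k\<in>J. 0 \<le> p k"
    proof
      fix k assume "k \<in> J"
      then show "0 \<le> p k" using I[of k] t[of k] by (auto simp: p_def)
    qed
    then show ?thesis unfolding cone_of_def by blast
  qed
  moreover have "(\<Sum>k\<in>J. p k *\<^sub>R b k) \<in> cone_of b I"
  proof -
    have "\<forall>k\<in>I. 0 \<le> q k"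
      using J t0 by (auto simp: q_def)
    then show ?thesis unfolding pq cone_of_def by blast
  qed
  ultimately have "(\<Sum>k\<in>J. p k *\<^sub>R b k) \<in> cone_of b (I \<inter> J)"
    using fan IJ unfolding simplicial_fan_def by blast
  then obtain d where d: "(\<Sum>k\<in>J. p k *\<^sub>R b k) = (\<Sum>k\<in>I \<inter> J. d k *\<^sub>R b k)"
    unfolding cone_of_def by blast
  define d' where "d' k = (if k \<in> I \<inter> J then d k else 0)" for k
  have dJ: "(\<Sum>k\<in>J. p k *\<^sub>R b k) = (\<Sum>k\<in>J. d' k *\<^sub>R b k)"
    unfolding d by (intro sum.mono_neutral_cong_left) (auto simp: d'_def)
  have dI: "(\<Sum>k\<in>I. q k *\<^sub>R b k) = (\<Sum>k\<in>I. d' k *\<^sub>R b k)"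
    unfolding pq[symmetric] d by (intro sum.mono_neutral_cong_left) (auto simp: d'_def)
  have indI: "inj_on b I" "independent (b ` I)" and indJ: "inj_on b J" "independent (b ` J)"
    using fan IJ unfolding simplicial_fan_def by auto
  have p: "p k = d' k" if "k \<in> J" for k
    using independent_family_cong[OF indJ dJ that] .
  have q: "q k = d' k" if "k \<in> I" for k
    using independent_family_cong[OF indI dI that] .
  \<comment> \<open>On \<open>J - I\<close> and on \<open>I - J\<close> the common coefficient
    \<open>d'\<close> is 0; on the intersection \<open>t + u k\<close> and \<open>t\<close> both
    equal \<open>d' k\<close>; off both simplices the two sign conditions meet.\<close>
  show ?thesis
    using p[of k] q[of k] I[of k] J[of k]
    by (cases "k \<in> I"; cases "k \<in> J") (auto simp: p_def q_def d'_def)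
qed

text \<open>Since the unit sphere is compact, the vanishing of sign-constrained relations becomes properness
  of the radial action.\<close>

lemma fan_relation_bounded:
  fixes b :: "'m::finite \<Rightarrow> real^'n" and M :: real
  assumes fan: "simplicial_fan \<Sigma> b" and J: "J \<in> \<Sigma>"
  obtains B where "\<And>I (y::real^'m). I \<in> \<Sigma> \<Longrightarrow> (\<Sum>k\<in>UNIV. y$k *\<^sub>R b k) = 0 \<Longrightarrow>
     (\<And>k. k \<notin> J \<Longrightarrow> y$k \<le> M) \<Longrightarrow> (\<And>k. k \<notin> I \<Longrightarrow> - M \<le> y$k) \<Longrightarrow> norm y \<le> B"
proof -
  have ex: "\<exists>B. \<forall>y::real^'m. (\<Sum>k\<in>UNIV. y$k *\<^sub>R b k) = 0 \<longrightarrow>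
     (\<forall>k. k \<notin> J \<longrightarrow> y$k \<le> M) \<longrightarrow> (\<forall>k. k \<notin> I \<longrightarrow> - M \<le> y$k) \<longrightarrow> norm y \<le> B" if I: "I \<in> \<Sigma>" for I
  proof -
    define K where "K = sphere (0::real^'m) 1 \<inter> {u. (\<Sum>k\<in>UNIV. u$k *\<^sub>R b k) = 0}"
    \<comment> \<open>\<open>\<phi>\<close> measures by how much the sign conditions fail. It is
      continuous and positively homogeneous, and by \<open>fan_relation_eq_0\<close> it has no zero
      among the unit relations.\<close>
    define \<phi> where "\<phi> u = (\<Sum>k\<in>-J. max 0 (u$k)) + (\<Sum>k\<in>-I. max 0 (- u$k))" for u :: "real^'m"
    have K: "compact K"
      unfolding K_def by (intro compact_Int_closed compact_sphere closed_Collect_eq continuous_intros)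
    have cont: "continuous_on K \<phi>"
      unfolding \<phi>_def by (intro continuous_intros)
    have pos: "0 < \<phi> u" if "u \<in> K" for u
    proof (rule ccontr)
      assume "\<not> 0 < \<phi> u"
      moreover have "0 \<le> (\<Sum>k\<in>-J. max 0 (u$k))" "0 \<le> (\<Sum>k\<in>-I. max 0 (- u$k))"
        by (auto intro!: sum_nonneg)
      ultimately have "(\<Sum>k\<in>-J. max 0 (u$k)) = 0" "(\<Sum>k\<in>-I. max 0 (- u$k)) = 0"
        unfolding \<phi>_def by linarith+
      then have "\<forall>k\<in>-J. max 0 (u$k) = 0" "\<forall>k\<in>-I. max 0 (- u$k) = 0"
        by (simp_all add: sum_nonneg_eq_0_iff)
      then have uJ: "max 0 (u$k) = 0" if "k \<notin> J" for k
        using that by blast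
      have uI: "max 0 (- u$k) = 0" if "k \<notin> I" for k
        using \<open>\<forall>k\<in>-I. max 0 (- u$k) = 0\<close> that by blast
      have "u$k \<le> 0" if "k \<notin> J" for k
        using uJ[OF that] max.cobounded2[of "u$k" 0] by simp
      moreover have "0 \<le> u$k" if "k \<notin> I" for k
        using uI[OF that] max.cobounded2[of "- u$k" 0] by simp
      moreover have "(\<Sum>k\<in>UNIV. u$k *\<^sub>R b k) = 0" using \<open>u \<in> K\<close> by (simp add: K_def)
      ultimately have "u $ k = 0" for k
        using fan_relation_eq_0[OF fan I J, of "\<lambda>k. u$k" k] by simp
      then have "u = 0" by (simp add: vec_eq_iff)
      then show False using \<open>u \<in> K\<close> by (simp add: K_def)
    qed
    \<comment> \<open>On an empty \<open>K\<close> there is no minimum to take, and any positive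
      \<open>\<delta>\<close> serves.\<close>
    obtain \<delta> where \<delta>: "0 < \<delta>" "\<And>u. u \<in> K \<Longrightarrow> \<delta> \<le> \<phi> u"
    proof (cases "K = {}")
      case True
      then show ?thesis using that[of 1] by simp
    next
      case False
      then show ?thesis using continuous_attains_inf[OF K False cont] pos that by metis
    qed
    \<comment> \<open>Each summand of \<open>\<phi> y\<close> is at most
      \<open>\<bar>M\<bar>\<close>; the absolute value covers negative \<open>M\<close>.\<close>
    define N where "N = real (card (-J) + card (-I)) * \<bar>M\<bar>"
    have "norm y \<le> N / \<delta>" if y: "(\<Sum>k\<in>UNIV. y$k *\<^sub>R b k) = 0" "\<forall>k. k \<notin> J \<longrightarrow> y$k \<le> M"
      "\<forall>k. k \<notin> I \<longrightarrow> - M \<le> y$k" for y :: "real^'m"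
    proof (cases "y = 0")
      case True
      then show ?thesis using \<delta> by (simp add: N_def)
    next
      case False
      define u where "u = (1 / norm y) *\<^sub>R y"
      have "(\<Sum>k\<in>UNIV. u$k *\<^sub>R b k) = (1 / norm y) *\<^sub>R (\<Sum>k\<in>UNIV. y$k *\<^sub>R b k)"
        by (simp add: u_def scaleR_sum_right)
      then have "u \<in> K" using y(1) False by (simp add: K_def u_def)
      then have "\<delta> \<le> \<phi> u" by (rule \<delta>(2))
      have yu: "y = norm y *\<^sub>R u" using False by (simp add: u_def)
      have "max 0 (y$k) = norm y * max 0 (u$k)" "max 0 (- y$k) = norm y * max 0 (- u$k)" for k
        by (subst yu, simp add: max_def mult_le_0_iff zero_le_mult_iff False)+
      then have "\<phi> y = norm y * \<phi> u"
        unfolding \<phi>_def by (simp add: sum_distrib_left distrib_left)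
      moreover have "\<phi> y \<le> N"
      proof -
        have "(\<Sum>k\<in>-J. max 0 (y$k)) \<le> of_nat (card (-J)) * \<bar>M\<bar>"
          using y(2) by (intro sum_bounded_above) (auto intro: order_trans[OF _ abs_ge_self])
        moreover have "(\<Sum>k\<in>-I. max 0 (- y$k)) \<le> of_nat (card (-I)) * \<bar>M\<bar>"
          using y(3) by (intro sum_bounded_above) force
        ultimately show ?thesis unfolding \<phi>_def N_def by (simp add: distrib_right)
      qed
      moreover have "norm y * \<delta> \<le> norm y * \<phi> u"
        using \<open>\<delta> \<le> \<phi> u\<close> by (simp add: mult_left_mono)
      ultimately show ?thesis using \<delta>(1) by (simp add: field_simps)
    qed
    then show ?thesis by blast
  qed
  then obtain B where B: "\<And>I y. I \<in> \<Sigma> \<Longrightarrow> (\<Sum>k\<in>UNIV. y$k *\<^sub>R b k) = 0 \<Longrightarrow>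
     (\<forall>k. k \<notin> J \<longrightarrow> y$k \<le> M) \<Longrightarrow> (\<forall>k. k \<notin> I \<longrightarrow> - M \<le> y$k) \<Longrightarrow> norm (y::real^'m) \<le> B I"
    by metis
  show ?thesis
  proof (rule that[of "Max (B ` \<Sigma>)"])
    fix I and y :: "real^'m"
    assume "I \<in> \<Sigma>" "(\<Sum>k\<in>UNIV. y$k *\<^sub>R b k) = 0"
      "\<And>k. k \<notin> J \<Longrightarrow> y$k \<le> M" "\<And>k. k \<notin> I \<Longrightarrow> - M \<le> y$k"
    then have "norm y \<le> B I" using B by blast
    also have "\<dots> \<le> Max (B ` \<Sigma>)" using \<open>I \<in> \<Sigma>\<close> by simp
    finally show "norm y \<le> Max (B ` \<Sigma>)" .
  qed
qed

subsection \<open>The radial action\<close>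

definition moment_angle :: "'m set set \<Rightarrow> (complex^'m) set" where
  "moment_angle \<Sigma> = {z. \<exists>I\<in>\<Sigma>. \<forall>k. cmod (z$k) \<le> 1 \<and> (k \<notin> I \<longrightarrow> cmod (z$k) = 1)}"

text \<open>By the first condition \<open>exp y\<close> is, up to phases, a kernel element of
  \<lambda>. This is a relation at first, since existence, uniqueness and closedness of the graph
  are proved separately.\<close>

definition balances :: "'m::finite set set \<Rightarrow> ('m \<Rightarrow> real^'n) \<Rightarrow> complex^'m \<Rightarrow> real^'m \<Rightarrow> bool" where
  "balances \<Sigma> b z y \<longleftrightarrow> (\<Sum>k\<in>UNIV. y$k *\<^sub>R b k) = 0 \<and>
     (\<chi> k. of_real (exp (y$k)) * z$k) \<in> moment_angle \<Sigma>"

lemma closed_moment_angle: "closed (moment_angle (\<Sigma> :: 'm::finite set set))"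
proof -
  have "moment_angle \<Sigma> = (\<Union>I\<in>\<Sigma>. \<Inter>k. {z. cmod (z$k) \<le> 1} \<inter> {z. k \<notin> I \<longrightarrow> cmod (z$k) = 1})"
    unfolding moment_angle_def by auto
  also have "closed \<dots>"
  proof (intro closed_UN ballI closed_INT closed_Int)
    show "closed {z::complex^'m. k \<notin> I \<longrightarrow> cmod (z$k) = 1}" for I :: "'m set" and k
    proof (cases "k \<in> I")
      case False
      then show ?thesis by (simp, intro closed_Collect_eq continuous_intros)
    qed auto
  qed (auto intro!: closed_Collect_le continuous_intros)
  finally show ?thesis .
qed

lemma moment_angle_subset: "moment_angle \<Sigma> \<subseteq> U_Sigma \<Sigma>"
proof
  fix z assume "z \<in> moment_angle \<Sigma>"
  then obtain I where I: "I \<in> \<Sigma>" "\<And>k. k \<notin> I \<Longrightarrow> cmod (z$k) = 1"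
    unfolding moment_angle_def by blast
  then have "z \<in> U_of I" unfolding U_of_def by force
  then show "z \<in> U_Sigma \<Sigma>" using I(1) unfolding U_Sigma_def by blast
qed

text \<open>Closedness lets balancing vectors pass to limits, both in the existence proof and in the
  closed graph argument for continuity.\<close>

lemma closed_balances:
  fixes b :: "'m::finite \<Rightarrow> real^'n"
  shows "closed {(z, y). balances \<Sigma> b z y}"
proof -
  have "{(z, y). balances \<Sigma> b z y} = {p. (\<Sum>k\<in>UNIV. snd p$k *\<^sub>R b k) = 0} \<inter>
      (\<lambda>p. \<chi> k. of_real (exp (snd p$k)) * fst p$k) -` moment_angle \<Sigma>"
    unfolding balances_def by auto
  also have "closed \<dots>"
    by (intro closed_Int closed_Collect_eq closed_vimage closed_moment_angle continuous_intros)
  finally show ?thesis .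
qed

text \<open>Off \<open>I\<close> the first move reaches modulus 1, the largest value allowed, so
  \<open>y'\<close> is at most \<open>y\<close> there; off \<open>J\<close> the roles are exchanged.
  Hence \<open>y - y'\<close> meets the sign conditions of \<open>fan_relation_eq_0\<close>.\<close>

lemma balances_unique:
  fixes b :: "'m::finite \<Rightarrow> real^'n"
  assumes fan: "simplicial_fan \<Sigma> b" and "balances \<Sigma> b z y" "balances \<Sigma> b z y'"
  shows "y = y'"
proof -
  obtain I where I: "I \<in> \<Sigma>" "\<And>k. exp (y$k) * cmod (z$k) \<le> 1" "\<And>k. k \<notin> I \<Longrightarrow> exp (y$k) * cmod (z$k) = 1"
    and y: "(\<Sum>k\<in>UNIV. y$k *\<^sub>R b k) = 0"
    using assms(2) unfolding balances_def moment_angle_def by (auto simp: norm_mult)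
  obtain J where J: "J \<in> \<Sigma>" "\<And>k. exp (y'$k) * cmod (z$k) \<le> 1" "\<And>k. k \<notin> J \<Longrightarrow> exp (y'$k) * cmod (z$k) = 1"
    and y': "(\<Sum>k\<in>UNIV. y'$k *\<^sub>R b k) = 0"
    using assms(3) unfolding balances_def moment_angle_def by (auto simp: norm_mult)
  have le: "s \<le> t" if "exp s * c \<le> 1" "exp t * c = 1" "0 \<le> c" for s t c :: real
  proof -
    have "0 < c" using that(2,3) by (cases "c = 0") auto
    moreover have "exp s * c \<le> exp t * c" using that by simp
    ultimately show ?thesis by simp
  qed
  have "(\<Sum>k\<in>UNIV. (y$k - y'$k) *\<^sub>R b k) = 0"
    using y y' by (simp add: scaleR_left_diff_distrib sum_subtractf)
  then have "y$k - y'$k = 0" for k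
    by (rule fan_relation_eq_0[OF fan I(1) J(1)])
      (use le[OF I(2) J(3)] le[OF J(2) I(3)] in auto)
  then show ?thesis by (simp add: vec_eq_iff)
qed

text \<open>The vanishing coordinates of \<open>z0\<close> form a simplex \<open>J\<close>. Off
  \<open>J\<close> nearby points stay away from 0, which bounds \<open>y\<close> above; off
  \<open>I\<close> the moved coordinates have modulus 1 while \<open>z\<close> is bounded, which
  bounds \<open>y\<close> below. Then \<open>fan_relation_bounded\<close> applies.\<close>

lemma balances_locally_bounded:
  fixes b :: "'m::finite \<Rightarrow> real^'n"
  assumes fan: "simplicial_fan \<Sigma> b" and z0: "z0 \<in> U_Sigma \<Sigma>"
  obtains e B where "0 < e" "\<And>z y. z \<in> ball z0 e \<Longrightarrow> balances \<Sigma> b z y \<Longrightarrow> norm y \<le> B"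
proof -
  define J where "J = {k. z0$k = 0}"
  obtain I0 where "I0 \<in> \<Sigma>" "J \<subseteq> I0" using z0 by (auto simp: U_Sigma_def U_of_def J_def)
  then have J: "J \<in> \<Sigma>" using fan by (auto simp: simplicial_fan_def)
  \<comment> \<open>Half the least nonzero modulus, so that coordinates off \<open>J\<close> keep
    modulus at least \<open>e\<close> in the ball. The inserted 1 provides for the case that all
    coordinates vanish.\<close>
  define e where "e = Min (insert 1 ((\<lambda>k. cmod (z0$k) / 2) ` (-J)))"
  have e: "0 < e" unfolding e_def by (auto simp: J_def)
  have e2: "2 * e \<le> cmod (z0$k)" if "k \<notin> J" for k
  proof -
    have "e \<le> cmod (z0$k) / 2" unfolding e_def by (rule Min_le) (use that in auto)
    then show ?thesis by simp
  qed
  define R where "R = norm z0 + e"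
  have R: "0 < R" using e by (simp add: R_def add_nonneg_pos)
  \<comment> \<open>One constant for both estimates: \<open>y$k\<close> is at most
    \<open>- ln e\<close> off \<open>J\<close> and at least \<open>- ln R\<close> off
    \<open>I\<close>.\<close>
  define M where "M = \<bar>ln e\<bar> + \<bar>ln R\<bar>"
  obtain B where B: "\<And>I (y::real^'m). I \<in> \<Sigma> \<Longrightarrow> (\<Sum>k\<in>UNIV. y$k *\<^sub>R b k) = 0 \<Longrightarrow>
     (\<And>k. k \<notin> J \<Longrightarrow> y$k \<le> M) \<Longrightarrow> (\<And>k. k \<notin> I \<Longrightarrow> - M \<le> y$k) \<Longrightarrow> norm y \<le> B"
    using fan_relation_bounded[OF fan J] by blast
  show ?thesis
  proof (rule that[OF e])
    fix z y assume z: "z \<in> ball z0 e" and bal: "balances \<Sigma> b z y"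
    obtain I where I: "I \<in> \<Sigma>" "\<And>k. exp (y$k) * cmod (z$k) \<le> 1" "\<And>k. k \<notin> I \<Longrightarrow> exp (y$k) * cmod (z$k) = 1"
      and y: "(\<Sum>k\<in>UNIV. y$k *\<^sub>R b k) = 0"
      using bal unfolding balances_def moment_angle_def by (auto simp: norm_mult)
    have diff: "cmod (z0$k - z$k) < e" for k
      using z Finite_Cartesian_Product.norm_nth_le[of "z0 - z" k]
      by (simp add: dist_norm)
    show "norm y \<le> B"
    proof (rule B[OF I(1) y])
      fix k assume "k \<notin> J"
      then have "e \<le> cmod (z$k)"
        using e2[of k] diff[of k] norm_triangle_ineq2[of "z0$k" "z$k"] by linarith
      then have "exp (y$k) * e \<le> 1"
        using I(2)[of k] mult_left_mono[of e "cmod (z$k)" "exp (y$k)", OF _ exp_ge_zero] by linarith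
      then have "exp (y$k + ln e) \<le> exp 0" using e by (simp add: exp_add)
      then show "y$k \<le> M" unfolding M_def exp_le_cancel_iff by linarith
    next
      fix k assume "k \<notin> I"
      have "cmod (z$k) \<le> R"
        using diff[of k] norm_triangle_ineq3[of "z0$k" "z$k"] Finite_Cartesian_Product.norm_nth_le[of z0 k]
        unfolding R_def by linarith
      then have "1 \<le> exp (y$k) * R"
        using I(3)[OF \<open>k \<notin> I\<close>] mult_left_mono[of "cmod (z$k)" R "exp (y$k)"] by simp
      then have "exp 0 \<le> exp (y$k + ln R)" using R by (simp add: exp_add)
      then show "- M \<le> y$k" unfolding M_def exp_le_cancel_iff by linarith
    qed
  qed
qed

text \<open>In logarithmic coordinates the radial action is translation by relations. Completeness
  rewrites the combination with coefficients \<open>- ln (cmod (z$k))\<close> as a point of one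
  cone, and its coefficients \<open>a k\<close> become minus the logarithms of the moved
  moduli.\<close>

lemma balances_exists_Ustar:
  fixes b :: "'m::finite \<Rightarrow> real^'n"
  assumes complete: "(\<Union>I\<in>\<Sigma>. cone_of b I) = UNIV" and z: "z \<in> Ustar"
  shows "\<exists>y. balances \<Sigma> b z y"
proof -
  obtain I where "I \<in> \<Sigma>" "(\<Sum>k\<in>UNIV. - ln (cmod (z$k)) *\<^sub>R b k) \<in> cone_of b I"
    using complete by blast
  then obtain a where a: "\<forall>k\<in>I. 0 \<le> a k"
    "(\<Sum>k\<in>UNIV. - ln (cmod (z$k)) *\<^sub>R b k) = (\<Sum>k\<in>I. a k *\<^sub>R b k)"
    unfolding cone_of_def by blast
  define y :: "real^'m" where "y = (\<chi> k. - ln (cmod (z$k)) - (if k \<in> I then a k else 0))"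
  have "(\<Sum>k\<in>I. a k *\<^sub>R b k) = (\<Sum>k\<in>UNIV. (if k \<in> I then a k else 0) *\<^sub>R b k)"
    by (rule sum.mono_neutral_cong_left) auto
  then have "(\<Sum>k\<in>UNIV. y$k *\<^sub>R b k) = 0"
    using a(2) unfolding y_def by (simp add: scaleR_left_diff_distrib sum_subtractf)
  moreover have "exp (y$k) * cmod (z$k) = exp (- (if k \<in> I then a k else 0))" for k
    using z by (simp add: y_def Ustar_def exp_diff exp_minus field_simps)
  ultimately have "balances \<Sigma> b z y"
    using a(1) \<open>I \<in> \<Sigma>\<close> unfolding balances_def moment_angle_def
    by (auto simp: norm_mult intro!: bexI[of _ I])
  then show ?thesis ..
qed

text \<open>Points with vanishing coordinates are limits of points of the big torus; properness keeps
  the balancing vectors of the latter bounded.\<close>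

lemma balances_exists:
  fixes b :: "'m::finite \<Rightarrow> real^'n"
  assumes fan: "simplicial_fan \<Sigma> b" and complete: "(\<Union>I\<in>\<Sigma>. cone_of b I) = UNIV"
    and z: "z \<in> U_Sigma \<Sigma>"
  shows "\<exists>y. balances \<Sigma> b z y"
proof -
  define w :: "nat \<Rightarrow> complex^'m" where "w i = (\<chi> k. if z$k = 0 then of_real (inverse (real (Suc i))) else z$k)" for i
  have "(\<lambda>i. w i $ k) \<longlonglongrightarrow> z $ k" for k
  proof (cases "z$k = 0")
    case True
    have "(\<lambda>i. complex_of_real (inverse (real (Suc i)))) \<longlonglongrightarrow> of_real 0"
      by (intro tendsto_of_real LIMSEQ_inverse_real_of_nat)
    then show ?thesis using True by (simp add: w_def)
  qed (simp add: w_def)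
  then have w: "w \<longlonglongrightarrow> z" by (intro vec_tendstoI)
  have wU: "w i \<in> Ustar" for i by (simp add: w_def Ustar_def flip: of_nat_Suc)
  then obtain y where y: "\<And>i. balances \<Sigma> b (w i) (y i)"
    using balances_exists_Ustar[OF complete wU] by metis
  obtain e B where e: "0 < e" and B: "\<And>z' y. z' \<in> ball z e \<Longrightarrow> balances \<Sigma> b z' y \<Longrightarrow> norm y \<le> B"
    using balances_locally_bounded[OF fan z] by blast
  obtain N where N: "\<And>i. i \<ge> N \<Longrightarrow> w i \<in> ball z e"
    using w e unfolding lim_sequentially by (metis dist_commute mem_ball)
  \<comment> \<open>After the shift by \<open>N\<close> the whole sequence lies where balancing
    vectors are bounded, so a subsequence converges.\<close>
  have "\<forall>i. y (i + N) \<in> cball 0 B" using B[OF N y] by simp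
  then obtain l r where r: "strict_mono r" "((\<lambda>i. y (i + N)) \<circ> r) \<longlonglongrightarrow> l"
    using compact_cball unfolding compact_def by metis
  have "(\<lambda>i. w (i + N)) \<longlonglongrightarrow> z" using w by (rule LIMSEQ_ignore_initial_segment)
  then have "((\<lambda>i. w (i + N)) \<circ> r) \<longlonglongrightarrow> z" using r(1) by (rule LIMSEQ_subseq_LIMSEQ)
  then have "(\<lambda>i. (((\<lambda>i. w (i + N)) \<circ> r) i, ((\<lambda>i. y (i + N)) \<circ> r) i)) \<longlonglongrightarrow> (z, l)"
    using r(2) by (rule tendsto_Pair)
  then have "(z, l) \<in> {(z, y). balances \<Sigma> b z y}"
    by (rule closed_sequentially[OF closed_balances, rotated]) (use y in auto)
  then show ?thesis by auto
qed

section \<open>The balancing vector as a continuous function\<close>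

definition balance :: "'m::finite set set \<Rightarrow> ('m \<Rightarrow> real^'n) \<Rightarrow> complex^'m \<Rightarrow> real^'m" where
  "balance \<Sigma> b z = (THE y. balances \<Sigma> b z y)"

lemma balances_balance:
  fixes b :: "'m::finite \<Rightarrow> real^'n"
  assumes "simplicial_fan \<Sigma> b" "(\<Union>I\<in>\<Sigma>. cone_of b I) = UNIV" "z \<in> U_Sigma \<Sigma>"
  shows "balances \<Sigma> b z (balance \<Sigma> b z)"
proof -
  have "\<exists>!y. balances \<Sigma> b z y"
    using balances_exists[OF assms] balances_unique[OF assms(1)] by blast
  then show ?thesis unfolding balance_def by (rule theI')
qed

text \<open>Near each point the values stay in a compact ball, and by uniqueness the graph is the
  closed set of balancing pairs; a map into a compact space with closed graph is continuous.\<close>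

lemma continuous_on_balance:
  fixes b :: "'m::finite \<Rightarrow> real^'n"
  assumes fan: "simplicial_fan \<Sigma> b" and complete: "(\<Union>I\<in>\<Sigma>. cone_of b I) = UNIV"
  shows "continuous_on (U_Sigma \<Sigma>) (balance \<Sigma> b)"
  unfolding continuous_on_eq_continuous_within
proof
  fix z0 assume z0: "z0 \<in> U_Sigma \<Sigma>"
  obtain e B where e: "0 < e" and B: "\<And>z y. z \<in> ball z0 e \<Longrightarrow> balances \<Sigma> b z y \<Longrightarrow> norm y \<le> B"
    using balances_locally_bounded[OF fan z0] by blast
  let ?S = "U_Sigma \<Sigma> \<inter> ball z0 e"
  have bal: "balances \<Sigma> b z (balance \<Sigma> b z)" if "z \<in> ?S" for z
    using balances_balance[OF fan complete] that by blast
  have im: "balance \<Sigma> b \<in> ?S \<rightarrow> cball 0 B"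
    using B bal by force
  have "(\<lambda>z. (z, balance \<Sigma> b z)) ` ?S = (?S \<times> cball 0 B) \<inter> {(z, y). balances \<Sigma> b z y}"
    using bal im balances_unique[OF fan bal] by (auto simp: image_iff)
  then have "closedin (top_of_set (?S \<times> cball 0 B)) ((\<lambda>z. (z, balance \<Sigma> b z)) ` ?S)"
    by (simp only: closedin_closed_Int[OF closed_balances])
  then have "continuous_on ?S (balance \<Sigma> b)"
    using continuous_closed_graph_eq[OF compact_cball im] by blast
  then have "continuous (at z0 within ?S) (balance \<Sigma> b)"
    using z0 e by (auto simp: continuous_on_eq_continuous_within)
  moreover have "at z0 within ?S = at z0 within U_Sigma \<Sigma>"
    by (rule at_within_nhd[of z0 "ball z0 e"]) (use e in auto)
  ultimately show "continuous (at z0 within U_Sigma \<Sigma>) (balance \<Sigma> b)" by simp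
qed

subsection \<open>The homomorphism \<open>\<lambda>\<close>\<close>

lemma cmult_assoc: "cmult (cmult g h) z = cmult g (cmult h z)"
  by (simp add: cmult_def mult.assoc)

lemma cmult_commute: "cmult g h = cmult h g"
  by (simp add: cmult_def mult.commute)

lemma cmult_Ustar: "g \<in> Ustar \<Longrightarrow> h \<in> Ustar \<Longrightarrow> cmult g h \<in> Ustar"
  by (simp add: cmult_def Ustar_def)

definition cinv :: "complex^'m \<Rightarrow> complex^'m" where
  "cinv h = (\<chi> k. inverse (h $ k))"

lemma cinv_Ustar: "h \<in> Ustar \<Longrightarrow> cinv h \<in> Ustar"
  by (simp add: cinv_def Ustar_def)

lemma cmult_cinv: "h \<in> Ustar \<Longrightarrow> cmult (cinv h) (cmult h z) = z"
  by (simp add: cinv_def cmult_def Ustar_def vec_eq_iff)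

lemma Rpow_mult:
  assumes "g \<noteq> 0" "h \<noteq> 0"
  shows "Rpow (g * h) \<mu> = Rpow g \<mu> * Rpow h \<mu>"
proof -
  have "g * h / complex_of_real (cmod (g * h)) = (g / of_real (cmod g)) * (h / of_real (cmod h))"
    by (simp add: norm_mult)
  then have "(g * h / complex_of_real (cmod (g * h))) powi snd \<mu> =
      (g / of_real (cmod g)) powi snd \<mu> * (h / of_real (cmod h)) powi snd \<mu>"
    by (simp only: power_int_mult_distrib)
  moreover have "exp (fst \<mu> * complex_of_real (ln (cmod (g * h)))) =
      exp (fst \<mu> * complex_of_real (ln (cmod g))) * exp (fst \<mu> * complex_of_real (ln (cmod h)))"
    using assms by (simp add: norm_mult ln_mult distrib_left exp_add)
  ultimately show ?thesis unfolding Rpow_def by (simp only: mult_ac)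
qed

lemma lam_cmult:
  assumes "g \<in> Ustar" "h \<in> Ustar"
  shows "lam \<beta> (cmult g h) = cmult (lam \<beta> g) (lam \<beta> h)"
  using assms by (simp add: lam_def cmult_def Ustar_def Rpow_mult prod.distrib vec_eq_iff)

lemma norm_Rpow:
  assumes "g \<noteq> 0"
  shows "cmod (Rpow g \<mu>) = exp (Re (fst \<mu>) * ln (cmod g))"
  using assms by (simp add: Rpow_def norm_mult norm_power_int norm_divide)

text \<open>The imaginary part of the exponent and the power of the unit \<open>g / cmod g\<close>
  contribute only factors of modulus 1, so moduli see just the real vectors.\<close>

lemma norm_lam:
  assumes "h \<in> Ustar"
  shows "cmod (lam \<beta> h $ j) = exp ((\<Sum>k\<in>UNIV. ln (cmod (h$k)) *\<^sub>R bvec \<beta> k) $ j)"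
  using assms
  by (simp add: lam_def Ustar_def norm_Rpow exp_sum bvec_def mult.commute flip: prod_norm)

lemma norm_lam_eq_1_iff:
  assumes "h \<in> Ustar"
  shows "(\<forall>j. cmod (lam \<beta> h $ j) = 1) \<longleftrightarrow> (\<Sum>k\<in>UNIV. ln (cmod (h$k)) *\<^sub>R bvec \<beta> k) = 0"
  unfolding norm_lam[OF assms] exp_eq_one_iff by (simp add: vec_eq_iff)

text \<open>On the compact torus \<open>ln (cmod (h$k)) = 0\<close> removes the complex exponents.
  This is how the equality of the integral vectors enters.\<close>

lemma lam_torus_cong:
  assumes "\<And>k. cmod (h$k) = 1" "\<And>k. vvec \<beta> k = vvec \<beta>' k"
  shows "lam \<beta> h = lam \<beta>' h"
  using assms by (simp add: lam_def Rpow_def vvec_def)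

lemma ker_lam_Ustar: "h \<in> ker_lam \<beta> \<Longrightarrow> h \<in> Ustar"
  by (simp add: ker_lam_def)

lemma one_ker_lam: "(\<chi> k. 1) \<in> ker_lam \<beta>"
  by (simp add: ker_lam_def Ustar_def lam_def Rpow_def)

lemma cmult_one: "cmult (\<chi> k. 1) z = z"
  by (simp add: cmult_def)

lemma cmult_ker_lam: "g \<in> ker_lam \<beta> \<Longrightarrow> h \<in> ker_lam \<beta> \<Longrightarrow> cmult g h \<in> ker_lam \<beta>"
  by (simp add: ker_lam_def cmult_Ustar lam_cmult) (simp add: cmult_def)

lemma lam_cinv:
  assumes "h \<in> Ustar"
  shows "cmult (lam \<beta> (cinv h)) (lam \<beta> h) = (\<chi> j. 1)"
proof -
  have "cmult (cinv h) h = (\<chi> k. 1)"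
    using cmult_cinv[OF assms, of "\<chi> k. 1"] by (simp add: cmult_commute[of h] cmult_one)
  then show ?thesis
    using lam_cmult[OF cinv_Ustar[OF assms] assms, of \<beta>] one_ker_lam[of \<beta>] by (simp add: ker_lam_def)
qed

lemma cinv_ker_lam:
  assumes "h \<in> ker_lam \<beta>"
  shows "cinv h \<in> ker_lam \<beta>"
  using assms lam_cinv[of h \<beta>]
  by (simp add: ker_lam_def cinv_Ustar) (simp add: cmult_def)

lemma mem_orbit_of_self: "z \<in> orbit_of \<beta> z"
  unfolding orbit_of_def using one_ker_lam cmult_one by (metis (mono_tags, lifting) mem_Collect_eq)

lemma orbit_of_cmult:
  assumes "h \<in> ker_lam \<beta>"
  shows "orbit_of \<beta> (cmult h z) = orbit_of \<beta> z"
proof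
  show "orbit_of \<beta> (cmult h z) \<subseteq> orbit_of \<beta> z"
    using assms cmult_ker_lam by (fastforce simp: orbit_of_def simp flip: cmult_assoc)
  have "cmult g z = cmult (cmult g (cinv h)) (cmult h z)" for g
    using assms by (simp add: cmult_assoc cmult_cinv ker_lam_Ustar)
  then show "orbit_of \<beta> z \<subseteq> orbit_of \<beta> (cmult h z)"
    using assms cmult_ker_lam cinv_ker_lam unfolding orbit_of_def by blast
qed

text \<open>\<open>X_act\<close> ranges over all lifts of a torus element along \<lambda>. Two lifts
  differ by a kernel element, so a single lift computes the action.\<close>

lemma X_act_orbit_of:
  assumes h: "h \<in> Ustar"
  shows "X_act \<beta> (lam \<beta> h) (orbit_of \<beta> z) = orbit_of \<beta> (cmult h z)"
proof
  show "X_act \<beta> (lam \<beta> h) (orbit_of \<beta> z) \<subseteq> orbit_of \<beta> (cmult h z)"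
  proof
    fix x assume "x \<in> X_act \<beta> (lam \<beta> h) (orbit_of \<beta> z)"
    then obtain g k where g: "g \<in> Ustar" "lam \<beta> g = lam \<beta> h" and k: "k \<in> ker_lam \<beta>"
      and x: "x = cmult g (cmult k z)"
      unfolding X_act_def orbit_of_def by blast
    have "lam \<beta> (cmult (cinv h) g) = (\<chi> j. 1)"
      using lam_cmult[OF cinv_Ustar[OF h] g(1)] lam_cinv[OF h] g(2) by metis
    then have "cmult (cinv h) g \<in> ker_lam \<beta>"
      using g(1) h by (simp add: ker_lam_def cmult_Ustar cinv_Ustar)
    then have "cmult (cmult (cinv h) g) k \<in> ker_lam \<beta>"
      using k by (rule cmult_ker_lam)
    moreover have "cmult (cmult (cmult (cinv h) g) k) (cmult h z) = cmult (cinv h) (cmult h x)"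
      by (simp add: x cmult_def mult_ac)
    ultimately show "x \<in> orbit_of \<beta> (cmult h z)"
      using cmult_cinv[OF h] unfolding orbit_of_def by auto
  qed
  show "orbit_of \<beta> (cmult h z) \<subseteq> X_act \<beta> (lam \<beta> h) (orbit_of \<beta> z)"
  proof
    fix x assume "x \<in> orbit_of \<beta> (cmult h z)"
    then obtain k where k: "k \<in> ker_lam \<beta>" "x = cmult h (cmult k z)"
      unfolding orbit_of_def by (auto simp: cmult_def mult_ac)
    then show "x \<in> X_act \<beta> (lam \<beta> h) (orbit_of \<beta> z)"
      using h unfolding X_act_def orbit_of_def by blast
  qed
qed

section \<open>Logarithmic coordinates and the span of the integral vectors\<close>

definition rvec :: "int^'n \<Rightarrow> real^'n" where
  "rvec v = (\<chi> j. of_int (v$j))"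

definition expvec :: "real^'m \<Rightarrow> real^'m \<Rightarrow> complex^'m" where
  "expvec y s = (\<chi> k. exp (of_real (y$k) + \<i> * of_real (s$k)))"

lemma expvec_Ustar: "expvec y s \<in> Ustar"
  by (simp add: expvec_def Ustar_def)

lemma norm_expvec: "cmod (expvec y s $ k) = exp (y$k)"
  by (simp add: expvec_def)

text \<open>In logarithmic coordinates \<lambda> is linear and block triangular, as the matrix form
  of the exponents suggests: \<open>y\<close> changes modulus and phase, \<open>s\<close> only the
  phase.\<close>

lemma lam_expvec:
  "lam \<beta> (expvec y s) $ j = exp (of_real ((\<Sum>k\<in>UNIV. y$k *\<^sub>R bvec \<beta> k) $ j) + \<i> * of_real
     (((\<Sum>k\<in>UNIV. y$k *\<^sub>R (\<chi> j. Im (fst (\<beta> k) $ j))) + (\<Sum>k\<in>UNIV. s$k *\<^sub>R rvec (vvec \<beta> k))) $ j))"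
proof -
  have "Rpow (expvec y s $ k) (fst (\<beta> k) $ j, snd (\<beta> k) $ j)
    = exp (of_real (y$k * Re (fst (\<beta> k) $ j)) + \<i> * of_real (y$k * Im (fst (\<beta> k) $ j) + s$k * of_int (snd (\<beta> k) $ j)))" for k
  proof -
    have "expvec y s $ k / complex_of_real (cmod (expvec y s $ k)) = exp (\<i> * of_real (s$k))"
      by (simp add: norm_expvec) (simp add: expvec_def exp_add exp_of_real)
    moreover have "fst (\<beta> k) $ j * of_real (y$k) + of_int (snd (\<beta> k) $ j) * (\<i> * of_real (s$k)) =
        of_real (y$k * Re (fst (\<beta> k) $ j)) + \<i> * of_real (y$k * Im (fst (\<beta> k) $ j) + s$k * of_int (snd (\<beta> k) $ j))"
      by (simp add: complex_eq_iff)
    ultimately show ?thesis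
      unfolding Rpow_def by (simp only: norm_expvec fst_conv snd_conv exp_power_int ln_exp flip: exp_add)
  qed
  then have "lam \<beta> (expvec y s) $ j = exp (\<Sum>k\<in>UNIV. of_real (y$k * Re (fst (\<beta> k) $ j)) +
      \<i> * of_real (y$k * Im (fst (\<beta> k) $ j) + s$k * of_int (snd (\<beta> k) $ j)))"
    by (simp only: lam_def vec_lambda_beta exp_sum finite)
  also have "(\<Sum>k\<in>UNIV. of_real (y$k * Re (fst (\<beta> k) $ j)) +
      \<i> * of_real (y$k * Im (fst (\<beta> k) $ j) + s$k * of_int (snd (\<beta> k) $ j))) =
    of_real ((\<Sum>k\<in>UNIV. y$k *\<^sub>R bvec \<beta> k) $ j) + \<i> * of_real
     (((\<Sum>k\<in>UNIV. y$k *\<^sub>R (\<chi> j. Im (fst (\<beta> k) $ j))) + (\<Sum>k\<in>UNIV. s$k *\<^sub>R rvec (vvec \<beta> k))) $ j)"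
    by (simp add: complex_eq_iff bvec_def rvec_def vvec_def sum.distrib)
  finally show ?thesis .
qed

lemma Z_basis_independent:
  fixes B :: "(int^'n) set"
  assumes B: "Z_basis B"
  shows "inj_on rvec B" "independent (rvec ` B)"
proof -
  show inj: "inj_on rvec B" by (auto simp: inj_on_def rvec_def vec_eq_iff)
  have fin: "finite B" using B by (simp add: Z_basis_def)
  let ?P = "\<lambda>x c. (\<forall>w. w \<notin> B \<longrightarrow> c w = 0) \<and> x = (\<Sum>w\<in>B. c w *s w)"
  have ex1: "\<exists>!c::int^'n \<Rightarrow> int. ?P x c" for x
    using B unfolding Z_basis_def by (elim conjE) (rule spec)
  \<comment> \<open>The coordinates of \<open>x\<close> in \<open>B\<close>, extended by 0. They are
    unique as functions, so additivity and the values on \<open>B\<close> follow by exhibiting a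
    second expansion.\<close>
  define a where "a x = (THE c. ?P x c)" for x
  have "?P x (a x)" for x
    unfolding a_def by (rule theI'[OF ex1])
  then have a0: "\<And>x w. w \<notin> B \<Longrightarrow> a x w = 0" and ax: "\<And>x. x = (\<Sum>w\<in>B. a x w *s w)"
    by blast+
  have uniq: "c = a x" if "\<And>w. w \<notin> B \<Longrightarrow> c w = 0" "x = (\<Sum>w\<in>B. c w *s w)" for c x
    unfolding a_def by (rule the1_equality[OF ex1, symmetric]) (use that in blast)
  have comb: "a (\<Sum>i\<in>UNIV. x$i *s axis i 1) w = (\<Sum>i\<in>UNIV. x$i * a (axis i 1) w)" for x :: "int^'n" and w
  proof -
    have "(\<Sum>i\<in>UNIV. x$i *s axis i 1) = (\<Sum>i\<in>UNIV. x$i *s (\<Sum>w\<in>B. a (axis i 1) w *s w))"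
      by (simp only: ax[symmetric])
    also have "\<dots> = (\<Sum>w\<in>B. (\<Sum>i\<in>UNIV. x$i * a (axis i 1) w) *s w)"
      by (simp add: vec_eq_iff sum_distrib_left sum_distrib_right mult.assoc sum.swap[of _ UNIV B])
    finally have "(\<lambda>w. \<Sum>i\<in>UNIV. x$i * a (axis i 1) w) = a (\<Sum>i\<in>UNIV. x$i *s axis i 1)"
      by (intro uniq) (simp_all add: a0)
    then show ?thesis by (rule fun_cong[symmetric])
  qed
  have aB: "a w' w = (if w = w' then 1 else 0)" if "w' \<in> B" for w' w
  proof -
    have "(\<lambda>w. if w = w' then 1 else 0) = a w'"
      by (rule uniq) (use that fin in \<open>auto simp: if_distrib[of "\<lambda>c. c *s _"] sum.delta cong: if_cong\<close>)
    then show ?thesis by (rule fun_cong[symmetric])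
  qed
  \<comment> \<open>The coordinate functionals of \<open>B\<close> extend from the integer lattice to real linear functionals dual to \<open>B\<close>.\<close>
  define \<phi> where "\<phi> w x = (\<Sum>i\<in>UNIV. x$i * real_of_int (a (axis i 1) w))" for w and x :: "real^'n"
  have \<phi>: "\<phi> w (rvec w') = (if w = w' then 1 else 0)" if "w' \<in> B" for w w'
  proof -
    have "w' = (\<Sum>i\<in>UNIV. w'$i *s axis i 1)"
      by (simp add: vec_eq_iff axis_def if_distrib cong: if_cong)
    then have "real_of_int (a w' w) = \<phi> w (rvec w')"
      using comb[of w' w] by (simp add: \<phi>_def rvec_def)
    then show ?thesis using aB[OF that] by auto
  qed
  show "independent (rvec ` B)"
    unfolding independent_explicit_finite_subsets
  proof (intro allI impI ballI, goal_cases)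
    case (1 A u v)
    then obtain w where w: "w \<in> B" "v = rvec w" by blast
    \<comment> \<open>The dual functional of \<open>w\<close> isolates the coefficient of
      \<open>v\<close> in the vanishing combination.\<close>
    have "0 = \<phi> w (\<Sum>v\<in>A. u v *\<^sub>R v)" using 1 by (simp add: \<phi>_def)
    also have "\<dots> = (\<Sum>v\<in>A. u v * \<phi> w v)"
      by (simp add: \<phi>_def sum_distrib_left sum_distrib_right sum.swap[of _ UNIV] mult_ac)
    also have "\<dots> = (\<Sum>x\<in>A. if x = v then u v else 0)"
    proof (rule sum.cong)
      fix x assume "x \<in> A"
      then obtain w' where "w' \<in> B" "x = rvec w'" using 1 by blast
      then show "u x * \<phi> w x = (if x = v then u v else 0)"
        using \<phi>[of w' w] w inj by (auto simp: inj_on_def)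
    qed simp
    also have "\<dots> = u v" using 1 by (simp add: sum.delta)
    finally show ?case by simp
  qed
qed

text \<open>A simplex of dimension \<open>CARD('n) - 1\<close> has \<open>CARD('n)\<close> vertices.
  Non-singularity makes their integral vectors independent over the reals, so they already
  span.\<close>

lemma surj_vvec:
  assumes "topological_fan \<Sigma> \<beta>" "nonsingular_fan \<Sigma> (\<beta> :: 'm::finite \<Rightarrow> (complex^'n::finite) \<times> (int^'n))"
  shows "surj (\<lambda>s::real^'m. \<Sum>k\<in>UNIV. s$k *\<^sub>R rvec (vvec \<beta> k))"
proof -
  obtain I where I: "I \<in> \<Sigma>" "card I = CARD('n)"
    using assms(1) unfolding topological_fan_def simplicial_complex_on_def by auto
  obtain B where B: "inj_on (vvec \<beta>) I" "vvec \<beta> ` I \<subseteq> B" "Z_basis B"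
    using assms(2) I(1) unfolding nonsingular_fan_def part_of_Z_basis_def by blast
  let ?V = "rvec ` vvec \<beta> ` I"
  have ind: "independent ?V"
    using Z_basis_independent(2)[OF B(3)] B(2) by (meson image_mono independent_mono)
  have card: "card ?V = CARD('n)"
    using I(2) B Z_basis_independent(1)[OF B(3)] by (metis card_image inj_on_subset)
  have "UNIV \<subseteq> span ?V"
    by (rule card_ge_dim_independent) (use ind card in auto)
  moreover have "span ?V \<subseteq> range (\<lambda>s::real^'m. \<Sum>k\<in>UNIV. s$k *\<^sub>R rvec (vvec \<beta> k))"
  proof (rule span_minimal)
    show "?V \<subseteq> range (\<lambda>s::real^'m. \<Sum>k\<in>UNIV. s$k *\<^sub>R rvec (vvec \<beta> k))"
    proof clarify
      fix i
      have "rvec (vvec \<beta> i) = (\<Sum>k\<in>UNIV. (axis i 1 :: real^'m)$k *\<^sub>R rvec (vvec \<beta> k))"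
        by (simp add: axis_def if_distrib[of "\<lambda>c. c *\<^sub>R _"] cong: if_cong)
      then show "rvec (vvec \<beta> i) \<in> range (\<lambda>s::real^'m. \<Sum>k\<in>UNIV. s$k *\<^sub>R rvec (vvec \<beta> k))" by blast
    qed
    have "linear (\<lambda>s::real^'m. \<Sum>k\<in>UNIV. s$k *\<^sub>R rvec (vvec \<beta> k))"
      by (intro linearI) (simp_all add: scaleR_left_distrib sum.distrib scaleR_sum_right)
    then show "subspace (range (\<lambda>s::real^'m. \<Sum>k\<in>UNIV. s$k *\<^sub>R rvec (vvec \<beta> k)))"
      by (rule linear_subspace_image) simp
  qed
  ultimately show ?thesis by blast
qed

subsection \<open>Orbits and the moment-angle complex\<close>

lemma moment_angle_cong:
  assumes "\<And>k. cmod (z$k) = cmod (w$k)"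
  shows "z \<in> moment_angle \<Sigma> \<longleftrightarrow> w \<in> moment_angle \<Sigma>"
  using assms by (simp add: moment_angle_def)

lemma simplicial_fan_bvec: "topological_fan \<Sigma> \<beta> \<Longrightarrow> simplicial_fan \<Sigma> (bvec \<beta>)"
  unfolding topological_fan_def simplicial_fan_def simplicial_complex_on_def by blast

text \<open>Both 0 and the vector of logarithms \<open>ln (cmod (h$k))\<close> balance
  \<open>z\<close>, so they agree by uniqueness.\<close>

lemma moment_angle_return_torus:
  fixes \<beta> :: "'m::finite \<Rightarrow> (complex^'n) \<times> (int^'n)"
  assumes fan: "simplicial_fan \<Sigma> (bvec \<beta>)" and z: "z \<in> moment_angle \<Sigma>"
    and h: "h \<in> Ustar" "\<forall>j. cmod (lam \<beta> h $ j) = 1" and hz: "cmult h z \<in> moment_angle \<Sigma>"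
  shows "cmod (h$k) = 1"
proof -
  define y :: "real^'m" where "y = (\<chi> k. ln (cmod (h$k)))"
  have exp_y: "exp (y$k) = cmod (h$k)" for k
    using h(1) by (simp add: y_def Ustar_def)
  have "(\<Sum>k\<in>UNIV. y$k *\<^sub>R bvec \<beta> k) = 0"
    using norm_lam_eq_1_iff[OF h(1), of \<beta>] h(2) by (simp add: y_def)
  moreover have "(\<chi> k. of_real (exp (y$k)) * z$k) \<in> moment_angle \<Sigma>"
    using hz by (subst moment_angle_cong[where w = "cmult h z"]) (simp_all add: exp_y cmult_def norm_mult)
  ultimately have "balances \<Sigma> (bvec \<beta>) z y" by (simp add: balances_def)
  moreover have "balances \<Sigma> (bvec \<beta>) z 0"
    using z by (simp add: balances_def)
  ultimately have "y = 0" by (rule balances_unique[OF fan])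
  then show ?thesis using exp_y[of k] by simp
qed

lemma moment_angle_retraction:
  fixes \<beta> :: "'m::finite \<Rightarrow> (complex^'n::finite) \<times> (int^'n)"
  assumes fan: "topological_fan \<Sigma> \<beta>" "complete_fan \<Sigma> \<beta>" "nonsingular_fan \<Sigma> \<beta>"
  obtains r where "continuous_on (U_Sigma \<Sigma>) r" "r ` U_Sigma \<Sigma> \<subseteq> moment_angle \<Sigma>"
    "\<And>z. z \<in> U_Sigma \<Sigma> \<Longrightarrow> orbit_of \<beta> (r z) = orbit_of \<beta> z"
proof -
  have sf: "simplicial_fan \<Sigma> (bvec \<beta>)" using fan(1) by (rule simplicial_fan_bvec)
  have complete: "(\<Union>I\<in>\<Sigma>. cone_of (bvec \<beta>) I) = UNIV" using fan(2) by (simp add: complete_fan_def)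
  let ?A = "\<lambda>s::real^'m. \<Sum>k\<in>UNIV. s$k *\<^sub>R rvec (vvec \<beta> k)"
  let ?C = "\<lambda>y::real^'m. \<Sum>k\<in>UNIV. y$k *\<^sub>R (\<chi> j. Im (fst (\<beta> k) $ j))"
  have "linear ?A"
    by (intro linearI) (simp_all add: scaleR_left_distrib sum.distrib scaleR_sum_right)
  \<comment> \<open>A linear choice of preimages makes the phases depend continuously on
    \<open>y\<close>.\<close>
  then obtain S where S: "linear S" "?A \<circ> S = id"
    using linear_surjective_right_inverse surj_vvec[OF fan(1,3)] by blast
  have AS: "?A (S x) = x" for x
    using fun_cong[OF S(2), of x] by simp
  \<comment> \<open>The phases undo the rotation that the imaginary parts c cause on radial elements.\<close>
  define h where "h y = expvec y (S (- ?C y))" for y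
  have h: "h y \<in> ker_lam \<beta>" if "(\<Sum>k\<in>UNIV. y$k *\<^sub>R bvec \<beta> k) = 0" for y
    unfolding ker_lam_def h_def using that
    by (simp add: expvec_Ustar vec_eq_iff lam_expvec AS)
  let ?Y = "balance \<Sigma> (bvec \<beta>)"
  have bal: "balances \<Sigma> (bvec \<beta>) z (?Y z)" if "z \<in> U_Sigma \<Sigma>" for z
    using balances_balance[OF sf complete that] .
  have contS: "continuous_on UNIV S" using S(1) by (simp add: linear_continuous_on linear_linear)
  have cont_h: "continuous_on UNIV h"
    unfolding h_def expvec_def
    by (intro continuous_intros continuous_on_compose2[OF contS]) auto
  show ?thesis
  proof (rule that[of "\<lambda>z. cmult (h (?Y z)) z"])
    have "continuous_on (U_Sigma \<Sigma>) (\<lambda>z. h (?Y z))"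
      using continuous_on_balance[OF sf complete] by (rule continuous_on_compose2[OF cont_h]) simp
    then show "continuous_on (U_Sigma \<Sigma>) (\<lambda>z. cmult (h (?Y z)) z)"
      unfolding cmult_def by (intro continuous_intros)
    show "(\<lambda>z. cmult (h (?Y z)) z) ` U_Sigma \<Sigma> \<subseteq> moment_angle \<Sigma>"
    proof clarify
      fix z assume "z \<in> U_Sigma \<Sigma>"
      then have "(\<chi> k. of_real (exp (?Y z$k)) * z$k) \<in> moment_angle \<Sigma>"
        using bal by (simp add: balances_def)
      then show "cmult (h (?Y z)) z \<in> moment_angle \<Sigma>"
        by (subst moment_angle_cong) (auto simp: cmult_def h_def norm_mult norm_expvec)
    qed
    show "orbit_of \<beta> (cmult (h (?Y z)) z) = orbit_of \<beta> z" if "z \<in> U_Sigma \<Sigma>" for z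
      using bal[OF that] h by (simp add: orbit_of_cmult balances_def)
  qed
qed

section \<open>Quotient topology and transfer of orbits\<close>

lemma quotient_map_X_space: "quotient_map (top_of_set (U_Sigma \<Sigma>)) (X_space \<Sigma> \<beta>) (orbit_of \<beta>)"
proof -
  have op: "openin (X_space \<Sigma> \<beta>) = quot_open (top_of_set (U_Sigma \<Sigma>)) (orbit_of \<beta>)"
    by (simp add: X_space_def quotient_topology_def istopology_quot_open)
  have "{z \<in> topspace (top_of_set (U_Sigma \<Sigma>)). orbit_of \<beta> z \<in> orbit_of \<beta> ` U_Sigma \<Sigma>} = U_Sigma \<Sigma>"
    by auto
  then have "openin (X_space \<Sigma> \<beta>) (orbit_of \<beta> ` U_Sigma \<Sigma>)"
    unfolding op quot_open_def by simp
  then have "orbit_of \<beta> ` U_Sigma \<Sigma> \<subseteq> topspace (X_space \<Sigma> \<beta>)"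
    by (rule openin_subset)
  moreover have "topspace (X_space \<Sigma> \<beta>) \<subseteq> orbit_of \<beta> ` U_Sigma \<Sigma>"
    using openin_topspace[of "X_space \<Sigma> \<beta>"] unfolding op quot_open_def by simp
  ultimately have "topspace (X_space \<Sigma> \<beta>) = orbit_of \<beta> ` U_Sigma \<Sigma>"
    by (rule antisym[rotated])
  then show ?thesis unfolding quotient_map_def op quot_open_def by simp
qed

lemma topspace_X_space: "topspace (X_space \<Sigma> \<beta>) = orbit_of \<beta> ` U_Sigma \<Sigma>"
  using quotient_imp_surjective_map[OF quotient_map_X_space[of \<Sigma> \<beta>]] by simp

text \<open>Here \<beta> is the target fan. The union avoids the choice of a representative: for an
  orbit of the source fan, all orbits joined coincide.\<close>

definition orbit_transfer ::
  "'m::finite set set \<Rightarrow> ('m \<Rightarrow> (complex^'n) \<times> (int^'n)) \<Rightarrow> (complex^'m) set \<Rightarrow> (complex^'m) set" where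
  "orbit_transfer \<Sigma> \<beta> Ob = (\<Union>z\<in>Ob \<inter> moment_angle \<Sigma>. orbit_of \<beta> z)"

text \<open>Points of the moment-angle complex in one orbit of \<beta> differ by a kernel element in
  the compact torus. There both homomorphisms agree, so it lies in the kernel for \<beta>'
  too.\<close>

lemma orbit_transfer_orbit_of:
  assumes fan: "simplicial_fan \<Sigma> (bvec \<beta>)" and v: "\<And>i. vvec \<beta> i = vvec \<beta>' i"
    and z: "z \<in> moment_angle \<Sigma>"
  shows "orbit_transfer \<Sigma> \<beta>' (orbit_of \<beta> z) = orbit_of \<beta>' z"
proof -
  have eq: "orbit_of \<beta>' w = orbit_of \<beta>' z" if w: "w \<in> orbit_of \<beta> z" "w \<in> moment_angle \<Sigma>" for w
  proof -
    obtain h where h: "h \<in> Ustar" "lam \<beta> h = (\<chi> j. 1)" "w = cmult h z"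
      using w(1) unfolding orbit_of_def ker_lam_def by blast
    have "cmod (h$k) = 1" for k
      by (rule moment_angle_return_torus[OF fan z h(1)]) (use h w(2) in auto)
    then have "lam \<beta>' h = lam \<beta> h"
      by (rule lam_torus_cong) (simp add: v)
    then have "h \<in> ker_lam \<beta>'" using h by (simp add: ker_lam_def)
    then show ?thesis unfolding h(3) by (rule orbit_of_cmult)
  qed
  show ?thesis
    unfolding orbit_transfer_def
  proof (rule SUP_eq_const)
    show "orbit_of \<beta> z \<inter> moment_angle \<Sigma> \<noteq> {}"
      using z mem_orbit_of_self by blast
  qed (erule IntE, rule eq)
qed

text \<open>Continuity is tested after composition with the quotient map, where the transfer becomes
  the retraction followed by \<open>orbit_of \<beta>'\<close>.\<close>

lemma continuous_map_orbit_transfer: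
  assumes "topological_fan \<Sigma> \<beta>" "complete_fan \<Sigma> \<beta>" "nonsingular_fan \<Sigma> \<beta>"
    and v: "\<And>i. vvec \<beta> i = vvec \<beta>' i"
  shows "continuous_map (X_space \<Sigma> \<beta>) (X_space \<Sigma> \<beta>') (orbit_transfer \<Sigma> \<beta>')"
proof (rule continuous_compose_quotient_map[OF quotient_map_X_space])
  obtain r where r: "continuous_on (U_Sigma \<Sigma>) r" "r ` U_Sigma \<Sigma> \<subseteq> moment_angle \<Sigma>"
    "\<And>z. z \<in> U_Sigma \<Sigma> \<Longrightarrow> orbit_of \<beta> (r z) = orbit_of \<beta> z"
    using moment_angle_retraction[OF assms(1-3)] by blast
  have "continuous_map (top_of_set (U_Sigma \<Sigma>)) (top_of_set (U_Sigma \<Sigma>)) r"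
    using r(1,2) moment_angle_subset[of \<Sigma>] by auto
  then have "continuous_map (top_of_set (U_Sigma \<Sigma>)) (X_space \<Sigma> \<beta>') (orbit_of \<beta>' \<circ> r)"
    using quotient_imp_continuous_map[OF quotient_map_X_space] by (rule continuous_map_compose)
  then show "continuous_map (top_of_set (U_Sigma \<Sigma>)) (X_space \<Sigma> \<beta>') (orbit_transfer \<Sigma> \<beta>' \<circ> orbit_of \<beta>)"
  proof (rule continuous_map_eq)
    fix z assume "z \<in> topspace (top_of_set (U_Sigma \<Sigma>))"
    then have z: "z \<in> U_Sigma \<Sigma>" by simp
    then have "orbit_transfer \<Sigma> \<beta>' (orbit_of \<beta> (r z)) = orbit_of \<beta>' (r z)"
      using r(2) by (intro orbit_transfer_orbit_of simplicial_fan_bvec assms(1) v) auto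
    then show "(orbit_of \<beta>' \<circ> r) z = (orbit_transfer \<Sigma> \<beta>' \<circ> orbit_of \<beta>) z"
      using r(3)[OF z] by simp
  qed
qed

lemma moment_angle_representative:
  assumes "topological_fan \<Sigma> \<beta>" "complete_fan \<Sigma> \<beta>" "nonsingular_fan \<Sigma> \<beta>"
    and "x \<in> topspace (X_space \<Sigma> \<beta>)"
  obtains z where "z \<in> moment_angle \<Sigma>" "x = orbit_of \<beta> z"
proof -
  obtain r where "continuous_on (U_Sigma \<Sigma>) r" and r: "r ` U_Sigma \<Sigma> \<subseteq> moment_angle \<Sigma>"
    "\<And>z. z \<in> U_Sigma \<Sigma> \<Longrightarrow> orbit_of \<beta> (r z) = orbit_of \<beta> z"
    using moment_angle_retraction[OF assms(1-3)] by blast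
  obtain z where z: "z \<in> U_Sigma \<Sigma>" "x = orbit_of \<beta> z"
    using assms(4) unfolding topspace_X_space by (rule imageE)
  have "r z \<in> moment_angle \<Sigma>" using r(1) z(1) by blast
  moreover have "x = orbit_of \<beta> (r z)" using r(2)[OF z(1)] z(2) by simp
  ultimately show ?thesis by (rule that)
qed

text \<open>One representative in the moment-angle complex computes the transfer in both
  directions.\<close>

lemma orbit_transfer_orbit_transfer:
  assumes fan: "topological_fan \<Sigma> \<beta>" "complete_fan \<Sigma> \<beta>" "nonsingular_fan \<Sigma> \<beta>"
    and fan': "topological_fan \<Sigma> \<beta>'" and v: "\<And>i. vvec \<beta> i = vvec \<beta>' i"
    and x: "x \<in> topspace (X_space \<Sigma> \<beta>)"
  shows "orbit_transfer \<Sigma> \<beta> (orbit_transfer \<Sigma> \<beta>' x) = x"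
proof -
  obtain z where z: "z \<in> moment_angle \<Sigma>" "x = orbit_of \<beta> z"
    using moment_angle_representative[OF fan x] .
  have "orbit_transfer \<Sigma> \<beta>' (orbit_of \<beta> z) = orbit_of \<beta>' z"
    using simplicial_fan_bvec[OF fan(1)] v z(1) by (rule orbit_transfer_orbit_of)
  moreover have "orbit_transfer \<Sigma> \<beta> (orbit_of \<beta>' z) = orbit_of \<beta> z"
    using simplicial_fan_bvec[OF fan'] v[symmetric] z(1) by (rule orbit_transfer_orbit_of)
  ultimately show ?thesis using z(2) by simp
qed

section \<open>Equivariance under the compact torus\<close>

lemma S1_torus_lift:
  fixes \<beta> :: "'m::finite \<Rightarrow> (complex^'n::finite) \<times> (int^'n)"
  assumes fan: "topological_fan \<Sigma> \<beta>" "nonsingular_fan \<Sigma> \<beta>" and t: "t \<in> S1_torus"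
  obtains h where "h \<in> Ustar" "\<And>k. cmod (h$k) = 1" "lam \<beta> h = t"
proof -
  \<comment> \<open>With radial part 0 the phases alone must produce the arguments of
    \<open>t\<close>, which keeps the lift in the compact torus.\<close>
  obtain s :: "real^'m" where s: "(\<Sum>k\<in>UNIV. s$k *\<^sub>R rvec (vvec \<beta> k)) = (\<chi> j. Arg (t$j))"
    using surjD[OF surj_vvec[OF fan]] by metis
  show ?thesis
  proof (rule that[of "expvec 0 s"])
    show "expvec 0 s \<in> Ustar" by (rule expvec_Ustar)
    show "cmod (expvec 0 s $ k) = 1" for k by (simp add: norm_expvec)
    have "exp (\<i> * of_real (Arg (t$j))) = t$j" for j
    proof -
      have "cmod (t$j) = 1" using t by (simp add: S1_torus_def)
      then show ?thesis using Arg_eq[of "t$j"] by fastforce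
    qed
    then show "lam \<beta> (expvec 0 s) = t"
      by (simp add: vec_eq_iff lam_expvec s)
  qed
qed

text \<open>A lift of \<open>t\<close> in the compact torus preserves the moment-angle complex and
  lifts \<open>t\<close> for both fans, so both sides are the orbit of the same point
  \<open>cmult h z\<close>.\<close>

lemma orbit_transfer_X_act:
  assumes fan: "topological_fan \<Sigma> \<beta>" "complete_fan \<Sigma> \<beta>" "nonsingular_fan \<Sigma> \<beta>"
    and v: "\<And>i. vvec \<beta> i = vvec \<beta>' i"
    and t: "t \<in> S1_torus" and x: "x \<in> topspace (X_space \<Sigma> \<beta>)"
  shows "orbit_transfer \<Sigma> \<beta>' (X_act \<beta> t x) = X_act \<beta>' t (orbit_transfer \<Sigma> \<beta>' x)"
proof -
  obtain z where z: "z \<in> moment_angle \<Sigma>" "x = orbit_of \<beta> z"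
    using moment_angle_representative[OF fan x] .
  obtain h where h: "h \<in> Ustar" "\<And>k. cmod (h$k) = 1" "lam \<beta> h = t"
    using S1_torus_lift[OF fan(1,3) t] by blast
  have h': "lam \<beta>' h = t" using lam_torus_cong[OF h(2) v] h(3) by simp
  have "cmult h z \<in> moment_angle \<Sigma>"
    using z(1) by (subst moment_angle_cong[where w = z]) (simp_all add: cmult_def norm_mult h(2))
  then have "orbit_transfer \<Sigma> \<beta>' (orbit_of \<beta> (cmult h z)) = orbit_of \<beta>' (cmult h z)"
    using simplicial_fan_bvec[OF fan(1)] v by (intro orbit_transfer_orbit_of)
  moreover have "orbit_transfer \<Sigma> \<beta>' (orbit_of \<beta> z) = orbit_of \<beta>' z"
    using simplicial_fan_bvec[OF fan(1)] v z(1) by (intro orbit_transfer_orbit_of)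
  ultimately show ?thesis
    using X_act_orbit_of[OF h(1), of \<beta> z] X_act_orbit_of[OF h(1), of \<beta>' z] z(2) h(3) h' by simp
qed

theorem theorem7p2:
  fixes \<Sigma> :: "'m::finite set set"
    and \<beta> \<beta>' :: "'m \<Rightarrow> (complex^'n::finite) \<times> (int^'n)"
  assumes "topological_fan \<Sigma> \<beta>" "complete_fan \<Sigma> \<beta>" "nonsingular_fan \<Sigma> \<beta>"
    and "topological_fan \<Sigma> \<beta>'" "complete_fan \<Sigma> \<beta>'" "nonsingular_fan \<Sigma> \<beta>'"
    and "\<forall>i. vvec \<beta> i = vvec \<beta>' i"
  shows "\<exists>f. homeomorphic_map (X_space \<Sigma> \<beta>) (X_space \<Sigma> \<beta>') f \<and>
    (\<forall>t\<in>S1_torus. \<forall>x\<in>topspace (X_space \<Sigma> \<beta>). f (X_act \<beta> t x) = X_act \<beta>' t (f x))"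
proof (intro exI[of _ "orbit_transfer \<Sigma> \<beta>'"] conjI ballI)
  have v: "\<And>i. vvec \<beta> i = vvec \<beta>' i" and v': "\<And>i. vvec \<beta>' i = vvec \<beta> i"
    using assms(7) by simp_all
  have "homeomorphic_maps (X_space \<Sigma> \<beta>) (X_space \<Sigma> \<beta>') (orbit_transfer \<Sigma> \<beta>') (orbit_transfer \<Sigma> \<beta>)"
    unfolding homeomorphic_maps_def
    using continuous_map_orbit_transfer[OF assms(1-3) v] continuous_map_orbit_transfer[OF assms(4-6) v']
      orbit_transfer_orbit_transfer[OF assms(1-4) v] orbit_transfer_orbit_transfer[OF assms(4-6,1) v']
    by simp
  then show "homeomorphic_map (X_space \<Sigma> \<beta>) (X_space \<Sigma> \<beta>') (orbit_transfer \<Sigma> \<beta>')"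
    using homeomorphic_map_maps by blast
  show "orbit_transfer \<Sigma> \<beta>' (X_act \<beta> t x) = X_act \<beta>' t (orbit_transfer \<Sigma> \<beta>' x)"
    if "t \<in> S1_torus" "x \<in> topspace (X_space \<Sigma> \<beta>)" for t x
    by (rule orbit_transfer_X_act[OF assms(1-3) v that])
qed

end
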